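(* For every real Banach space $X$, every $1\le p<\infty$ with conjugate exponent $p'$, and every $n,m\in\mathbb N$, $$\Lambda_{p',X^*}(n,m)=C_{p,X}(n,m)$$ as elements of $[0,\infty]$.
   Context: All Banach spaces are real; $\mathbb N=\{1,2,\ldots\}$; $[n]=\{1,\ldots,n\}$; $p'$ is the conjugate exponent of $p$, with $p'=\infty$ when $p=1$; $X^*$ is the Banach dual of $X$. Let $G_{m,n}=(\mathbb Z/(2m\mathbb Z))^n$ and $\Sigma_n=\{-1,1\}^n$. Let $e_j$ be the $j$-th standard basis vector; additions in $G_{m,n}$ are modulo $2m$. For a finite nonempty set $\Omega$, a Banach space $Y$ and $1\le r<\infty$, $L_r(\Omega;Y)$ is the space of all maps $F:\Omega\to Y$ with $\|F\|_{L_r(\Omega;Y)}=\bigl(|\Omega|^{-1}\sum_{\omega\in\Omega}\|F(\omega)\|_Y^r\bigr)^{1/r}$; for $r=\infty$ the norm is the maximum of $\|F(\omega)\|_Y$. For $F:G_{m,n}\to X$ define $(D_{\mathrm{long}}F)(x,j)=F(x+me_j)-F(x)$ for $(x,j)\in G_{m,n}\times[n]$ and $(D_{\mathrm{sgn}}F)(x,\varepsilon)=F(x+\varepsilon)-F(x)$ for $(x,\varepsilon)\in G_{m,n}\times\Sigma_n$. Their adjoints (for the normalized finite-sum dualities) are, for $g:G_{m,n}\times[n]\to X^*$ and $h:G_{m,n}\times\Sigma_n\to X^*$, $$D_{\mathrm{long}}^*g(x)=\frac1n\sum_{j=1}^n\bigl(g(x-me_j,j)-g(x,j)\bigr),\qquad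 D_{\mathrm{sgn}}^*h(x)=2^{-n}\sum_{\varepsilon\in\Sigma_n}\bigl(h(x-\varepsilon,\varepsilon)-h(x,\varepsilon)\bigr).$$ Define $$C_{p,X}(n,m)=\sup_{F:\,D_{\mathrm{sgn}}F\ne0}\frac{\|D_{\mathrm{long}}F\|_{L_p(G_{m,n}\times[n];X)}}{\|D_{\mathrm{sgn}}F\|_{L_p(G_{m,n}\times\Sigma_n;X)}}$$ over $F:G_{m,n}\to X$, with the convention $C_{p,X}(n,m)=+\infty$ when $\ker D_{\mathrm{sgn}}\not\subseteq\ker D_{\mathrm{long}}$, and $$\Lambda_{p',X^*}(n,m)=\sup_{g\ne0}\frac{\inf\{\|h\|_{L_{p'}(G_{m,n}\times\Sigma_n;X^* )}:D_{\mathrm{sgn}}^*h=D_{\mathrm{long}}^*g\}}{\|g\|_{L_{p'}(G_{m,n}\times[n];X^* )}}$$ over $g\in L_{p'}(G_{m,n}\times[n];X^* )$, where the infimum over an empty set is $+\infty$. Empty suprema of nonnegative quantities are $0$. *)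

theory Defs
  imports "HOL-Analysis.Analysis"
begin

text \<open>
  Elements of \<open>(\<int>/2m\<int>)\<^sup>n\<close> are represented by their coordinate functions with values in
  \<open>{0..<2m}\<close>, extended by \<open>undefined\<close> outside \<open>{1..n}\<close>, so that equality of functions is
  equality of group elements. Maps defined on a finite set \<open>\<Omega>\<close> are total functions of which
  only the values on \<open>\<Omega>\<close> are ever inspected.
\<close>

type_synonym coords = "nat \<Rightarrow> int"

definition grid :: "nat \<Rightarrow> nat \<Rightarrow> coords set" where
  "grid m n = {1..n} \<rightarrow>\<^sub>E {0..<2 * int m}"

definition signs :: "nat \<Rightarrow> coords set" where
  "signs n = {1..n} \<rightarrow>\<^sub>E {-1, 1}"

definition grid_add :: "nat \<Rightarrow> nat \<Rightarrow> coords \<Rightarrow> coords \<Rightarrow> coords" where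
  "grid_add m n x v = (\<lambda>i\<in>{1..n}. (x i + v i) mod (2 * int m))"

definition grid_diff :: "nat \<Rightarrow> nat \<Rightarrow> coords \<Rightarrow> coords \<Rightarrow> coords" where
  "grid_diff m n x v = (\<lambda>i\<in>{1..n}. (x i - v i) mod (2 * int m))"

definition basis_vec :: "nat \<Rightarrow> coords" where
  "basis_vec j = (\<lambda>i. if i = j then 1 else 0)"

definition D_long :: "nat \<Rightarrow> nat \<Rightarrow> (coords \<Rightarrow> 'a::real_normed_vector) \<Rightarrow> coords \<times> nat \<Rightarrow> 'a" where
  "D_long m n F = (\<lambda>(x, j). F (grid_add m n x (\<lambda>i. int m * basis_vec j i)) - F x)"

definition D_sgn :: "nat \<Rightarrow> nat \<Rightarrow> (coords \<Rightarrow> 'a::real_normed_vector) \<Rightarrow> coords \<times> coords \<Rightarrow> 'a" where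
  "D_sgn m n F = (\<lambda>(x, \<epsilon>). F (grid_add m n x \<epsilon>) - F x)"

definition D_long_adj :: "nat \<Rightarrow> nat \<Rightarrow> (coords \<times> nat \<Rightarrow> 'b::real_normed_vector) \<Rightarrow> coords \<Rightarrow> 'b" where
  "D_long_adj m n g x =
     (1 / real n) *\<^sub>R (\<Sum>j\<in>{1..n}. g (grid_diff m n x (\<lambda>i. int m * basis_vec j i), j) - g (x, j))"

definition D_sgn_adj :: "nat \<Rightarrow> nat \<Rightarrow> (coords \<times> coords \<Rightarrow> 'b::real_normed_vector) \<Rightarrow> coords \<Rightarrow> 'b" where
  "D_sgn_adj m n h x =
     (1 / 2 ^ n) *\<^sub>R (\<Sum>\<epsilon>\<in>signs n. h (grid_diff m n x \<epsilon>, \<epsilon>) - h (x, \<epsilon>))"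

text \<open>The norm of \<open>L\<^sub>r(\<Omega>; Y)\<close> for the uniform probability measure on a finite nonempty \<open>\<Omega>\<close>,
  meaningful for \<open>1 \<le> r \<le> \<infinity>\<close>.\<close>

definition Lr_norm :: "ereal \<Rightarrow> 'w set \<Rightarrow> ('w \<Rightarrow> 'b::real_normed_vector) \<Rightarrow> real" where
  "Lr_norm r \<Omega> F =
     (if r = \<infinity> then Max ((\<lambda>\<omega>. norm (F \<omega>)) ` \<Omega>)
      else ((\<Sum>\<omega>\<in>\<Omega>. norm (F \<omega>) powr real_of_ereal r) / real (card \<Omega>)) powr (1 / real_of_ereal r))"

definition conj_exponent :: "real \<Rightarrow> ereal" where
  "conj_exponent p = (if p = 1 then \<infinity> else ereal (p / (p - 1)))"

text \<open>In both constants the space of values is passed as a type argument. Suprema and infima are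
  taken in \<^typ>\<open>ennreal\<close>, where the empty supremum is \<open>0\<close> and the empty infimum is \<open>\<infinity>\<close>;
  all denominators that occur are positive.\<close>

definition C_const :: "real \<Rightarrow> 'a::banach itself \<Rightarrow> nat \<Rightarrow> nat \<Rightarrow> ennreal" where
  "C_const p X n m =
     (if \<forall>F :: coords \<Rightarrow> 'a. (\<forall>z\<in>grid m n \<times> signs n. D_sgn m n F z = 0)
            \<longrightarrow> (\<forall>z\<in>grid m n \<times> {1..n}. D_long m n F z = 0)
      then SUP F \<in> {F :: coords \<Rightarrow> 'a. \<exists>z\<in>grid m n \<times> signs n. D_sgn m n F z \<noteq> 0}.
             ennreal (Lr_norm (ereal p) (grid m n \<times> {1..n}) (D_long m n F))
             / ennreal (Lr_norm (ereal p) (grid m n \<times> signs n) (D_sgn m n F))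
      else \<infinity>)"

definition Lambda_const :: "ereal \<Rightarrow> 'b::banach itself \<Rightarrow> nat \<Rightarrow> nat \<Rightarrow> ennreal" where
  "Lambda_const r Y n m =
     (SUP g \<in> {g :: coords \<times> nat \<Rightarrow> 'b. \<exists>z\<in>grid m n \<times> {1..n}. g z \<noteq> 0}.
        (INF h \<in> {h :: coords \<times> coords \<Rightarrow> 'b. \<forall>x\<in>grid m n. D_sgn_adj m n h x = D_long_adj m n g x}.
           ennreal (Lr_norm r (grid m n \<times> signs n) h))
        / ennreal (Lr_norm r (grid m n \<times> {1..n}) g))"

end

theory Submission
  imports Defs "HOL-Library.Function_Algebras"
begin

text \<open>
  \<open>C\<close> is the best constant in \<open>\<parallel>D_long F\<parallel> \<le> C \<parallel>D_sgn F\<parallel>\<close>, and \<open>\<Lambda>\<close> is the best constant with which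
  \<open>D_sgn\<^sup>* h = D_long\<^sup>* g\<close> can be solved for \<open>h\<close>; they agree by duality. Write
  \<open>\<langle>F, g\<rangle>\<close> for the average over \<open>\<Omega>\<close> of \<open>g(\<omega>)(F(\<omega>))\<close>. For this pairing \<open>L\<^sub>p'(\<Omega>; X\<^sup>*)\<close> is
  isometrically the dual of \<open>L\<^sub>p(\<Omega>; X)\<close>, whatever the Banach space \<open>X\<close> is, since \<open>\<Omega>\<close> is finite:
  \<open>holder_pairing\<close> is one inequality, \<open>norming_dual_element\<close> says that it is attained from the side
  of \<open>F\<close>, and \<open>Lr_dual_representation\<close> that every bounded functional is a pairing with some \<open>g\<close> of
  the right norm. Translation by a group element permutes the grid, so \<open>D_long_adj\<close> and
  \<open>D_sgn_adj\<close> are adjoints for the pairing, and \<open>D_sgn\<^sup>* h = D_long\<^sup>* g\<close> means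
  \<open>\<langle>D_sgn F, h\<rangle> = \<langle>D_long F, g\<rangle>\<close> for all \<open>F\<close> (\<open>D_sgn_adj_eq_iff\<close>). This weak form is the only way in which
  the grid enters.

  Upper bound \<open>\<Lambda> \<le> C\<close> (\<open>dual_lifting\<close>): if \<open>C\<close> is finite and \<open>g\<close> is given, then
  \<open>D_sgn F \<mapsto> \<langle>D_long F, g\<rangle>\<close> is a functional on the range of \<open>D_sgn\<close> bounded by \<open>C \<parallel>g\<parallel>\<close>. A Hahn-Banach
  extension of it is the pairing with some \<open>h\<close> of norm at most \<open>C \<parallel>g\<parallel>\<close>, and this \<open>h\<close> is admissible
  for \<open>g\<close>.

  Lower bound \<open>C \<le> \<Lambda>\<close> (\<open>dual_testing\<close>): for given \<open>F\<close> choose \<open>g\<close> in the dual unit ball that norms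
  \<open>D_long F\<close>. Then \<open>\<parallel>D_long F\<parallel> = \<langle>D_sgn F, h\<rangle> \<le> \<parallel>D_sgn F\<parallel> \<parallel>h\<parallel>\<close> for every admissible \<open>h\<close>. If \<open>D_sgn F = 0\<close> while
  \<open>D_long F \<noteq> 0\<close>, this leaves no admissible \<open>h\<close> at all, so that both constants are infinite together.

  The Hahn-Banach theorem is proved through minimal sublinear functionals, which turn out to be
  linear; this avoids partially defined functionals. It is used for norming functionals on \<open>X\<close>
  and for the lifting on the space of \<open>X\<close>-valued functions.
\<close>

section \<open>Sublinear functionals and the Hahn-Banach theorem\<close>

text \<open>The pointwise operations make the functions \<open>\<Omega> \<rightarrow> X\<close> a real vector space, so that linearity
  and the Hahn-Banach theorem apply to \<open>L\<^sub>p(\<Omega>; X)\<close> without a separate type.\<close>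

instantiation "fun" :: (type, real_vector) real_vector
begin

definition scaleR_fun :: "real \<Rightarrow> ('a \<Rightarrow> 'b) \<Rightarrow> 'a \<Rightarrow> 'b" where
  "scaleR_fun c f = (\<lambda>x. c *\<^sub>R f x)"

instance
  by standard (simp_all add: scaleR_fun_def fun_eq_iff scaleR_add_right scaleR_add_left)

end

lemma scaleR_fun_apply [simp]: "(c *\<^sub>R f) x = c *\<^sub>R f x"
  by (simp add: scaleR_fun_def)

definition sublinear :: "('v::real_vector \<Rightarrow> real) \<Rightarrow> bool" where
  "sublinear q \<longleftrightarrow> (\<forall>x y. q (x + y) \<le> q x + q y) \<and> (\<forall>c x. 0 \<le> c \<longrightarrow> q (c *\<^sub>R x) = c * q x)"

lemma sublinear_add: "sublinear q \<Longrightarrow> q (x + y) \<le> q x + q y"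
  by (simp add: sublinear_def)

lemma sublinear_scale: "sublinear q \<Longrightarrow> 0 \<le> c \<Longrightarrow> q (c *\<^sub>R x) = c * q x"
  by (simp add: sublinear_def)

lemma sublinear_zero: "sublinear q \<Longrightarrow> q 0 = 0"
  using sublinear_scale[of q 0 0] by simp

lemma sublinear_minus: "sublinear q \<Longrightarrow> - q (- x) \<le> q x"
  using sublinear_add[of q x "- x"] sublinear_zero[of q] by simp

text \<open>Homogeneity as an inequality suffices: applied to \<open>c\<^sup>-\<^sup>1\<close> and \<open>c x\<close> it yields the reverse one.\<close>

lemma sublinearI:
  assumes add: "\<And>x y. q (x + y) \<le> q x + q y"
    and scale: "\<And>c x. 0 \<le> c \<Longrightarrow> q (c *\<^sub>R x) \<le> c * q x"
  shows "sublinear q"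
  unfolding sublinear_def
proof (intro conjI allI impI)
  fix c :: real and x
  assume c: "0 \<le> c"
  show "q (c *\<^sub>R x) = c * q x"
  proof (cases "c = 0")
    case True
    then show ?thesis using add[of 0 0] scale[of 0 0] by simp
  next
    case False
    then have "q x \<le> inverse c * q (c *\<^sub>R x)"
      using scale[of "inverse c" "c *\<^sub>R x"] c by simp
    then have "c * q x \<le> q (c *\<^sub>R x)"
      using c False by (simp add: field_simps)
    then show ?thesis using scale[OF c] by (simp add: order_antisym)
  qed
qed (rule add)

text \<open>A convex cone \<open>G\<close> of prescriptions ``\<open>a\<close> is a lower bound at \<open>v\<close>'' compatible with \<open>q\<close> can be built
  into \<open>q\<close>: the infimal convolution \<open>r(x) = inf {q(x + v) - a | (v, a) \<in> G}\<close> is finite because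
  \<open>a \<le> q(v)\<close> forces \<open>r(x) \<ge> -q(-x)\<close>, it is sublinear because \<open>G\<close> is a cone, and it lies below \<open>q\<close> because
  \<open>G\<close> contains the origin. Every linear functional below \<open>r\<close> then satisfies all the prescriptions, as
  \<open>r(-v) \<le> -a\<close>.\<close>

lemma sublinear_improve_on_cone:
  fixes q :: "'v::real_vector \<Rightarrow> real"
  assumes q: "sublinear q"
    and zero: "(0, 0) \<in> G"
    and add: "\<And>v a w b. (v, a) \<in> G \<Longrightarrow> (w, b) \<in> G \<Longrightarrow> (v + w, a + b) \<in> G"
    and scale: "\<And>c v a. 0 \<le> c \<Longrightarrow> (v, a) \<in> G \<Longrightarrow> (c *\<^sub>R v, c * a) \<in> G"
    and dom: "\<And>v a. (v, a) \<in> G \<Longrightarrow> a \<le> q v"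
  obtains r where "sublinear r" "\<And>x. r x \<le> q x" "\<And>v a. (v, a) \<in> G \<Longrightarrow> r (- v) \<le> - a"
proof -
  define r where "r x = (INF z\<in>G. q (x + fst z) - snd z)" for x
  have bdd: "bdd_below ((\<lambda>z. q (x + fst z) - snd z) ` G)" for x
  proof (rule bdd_belowI2[of _ "- q (- x)"])
    fix z assume "z \<in> G"
    then have "snd z \<le> q (fst z)" using dom[of "fst z" "snd z"] by simp
    also have "\<dots> \<le> q (x + fst z) + q (- x)"
      using sublinear_add[OF q, of "x + fst z" "- x"] by simp
    finally show "- q (- x) \<le> q (x + fst z) - snd z" by simp
  qed
  have upper: "r x \<le> q (x + v) - a" if "(v, a) \<in> G" for x v a
    unfolding r_def using cINF_lower[OF bdd that, of x] by simp
  have greatest: "k \<le> r x" if "\<And>v a. (v, a) \<in> G \<Longrightarrow> k \<le> q (x + v) - a" for k x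
    unfolding r_def using that zero by (intro cINF_greatest) auto
  have "sublinear r"
  proof (rule sublinearI)
    fix x y
    have *: "r (x + y) \<le> (q (x + v) - a) + (q (y + w) - b)"
      if "(v, a) \<in> G" "(w, b) \<in> G" for v a w b
    proof -
      have "r (x + y) \<le> q ((x + y) + (v + w)) - (a + b)"
        by (rule upper[OF add[OF that]])
      also have "q ((x + y) + (v + w)) \<le> q (x + v) + q (y + w)"
        using sublinear_add[OF q, of "x + v" "y + w"] by (simp add: algebra_simps)
      finally show ?thesis by simp
    qed
    have "r (x + y) - (q (x + v) - a) \<le> r y" if "(v, a) \<in> G" for v a
      by (rule greatest) (use *[OF that] in \<open>simp add: algebra_simps\<close>)
    then have "r (x + y) - r y \<le> r x"
      by (intro greatest) (simp add: algebra_simps)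
    then show "r (x + y) \<le> r x + r y" by simp
  next
    fix c :: real and x
    assume c: "0 \<le> c"
    show "r (c *\<^sub>R x) \<le> c * r x"
    proof (cases "c = 0")
      case True
      then show ?thesis using upper[OF zero, of 0] sublinear_zero[OF q] by simp
    next
      case False
      have "r (c *\<^sub>R x) / c \<le> q (x + v) - a" if "(v, a) \<in> G" for v a
      proof -
        have "r (c *\<^sub>R x) \<le> q (c *\<^sub>R (x + v)) - c * a"
          using upper[OF scale[OF c that], of "c *\<^sub>R x"] by (simp add: scaleR_add_right)
        also have "\<dots> = c * (q (x + v) - a)"
          by (simp only: sublinear_scale[OF q c] right_diff_distrib)
        finally show ?thesis
          using c False by (simp add: field_simps)
      qed
      then have "r (c *\<^sub>R x) / c \<le> r x" by (rule greatest)
      then show ?thesis using c False by (simp add: field_simps)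
    qed
  qed
  moreover have "r x \<le> q x" for x using upper[OF zero, of x] by simp
  moreover have "r (- v) \<le> - a" if "(v, a) \<in> G" for v a
    using upper[OF that, of "- v"] sublinear_zero[OF q] by simp
  ultimately show thesis using that by blast
qed

text \<open>Zorn's lemma for the reversed pointwise order. The pointwise infimum of a chain is bounded below
  by \<open>-q(-x)\<close>; it is subadditive because two members of a chain have their minimum in the chain.\<close>

lemma minimal_sublinear_below:
  fixes q :: "'v::real_vector \<Rightarrow> real"
  assumes q: "sublinear q"
  obtains r where "sublinear r" "r \<le> q" "\<And>s. sublinear s \<Longrightarrow> s \<le> r \<Longrightarrow> s = r"
proof -
  define S where "S = {r. sublinear r \<and> r \<le> q}"
  have "\<exists>m\<in>S. \<forall>s\<in>S. s \<le> m \<longrightarrow> s = m"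
  proof (rule predicate_Zorn[where P = "\<lambda>r s. s \<le> r"])
    show "partial_order_on S (relation_of (\<lambda>r s. s \<le> r) S)"
      by (auto simp: partial_order_on_def preorder_on_def relation_of_def refl_on_def
          trans_def antisym_def)
  next
    fix C assume C: "C \<in> Chains (relation_of (\<lambda>r s. s \<le> r) S)"
    have CS: "r \<in> S" if "r \<in> C" for r
      using C that by (auto simp: Chains_def relation_of_def)
    have total: "r \<le> s \<or> s \<le> r" if "r \<in> C" "s \<in> C" for r s
      using C that by (auto simp: Chains_def relation_of_def)
    show "\<exists>u\<in>S. \<forall>r\<in>C. u \<le> r"
    proof (cases "C = {}")
      case True
      then show ?thesis using q by (auto simp: S_def)
    next
      case False
      define u where "u x = (INF r\<in>C. r x)" for x
      have bdd: "bdd_below ((\<lambda>r. r x) ` C)" for x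
      proof (rule bdd_belowI2[of _ "- q (- x)"])
        fix r assume "r \<in> C"
        then have "sublinear r" "r (- x) \<le> q (- x)"
          using CS by (auto simp: S_def le_fun_def)
        then show "- q (- x) \<le> r x" using sublinear_minus[of r x] by simp
      qed
      have lower: "u x \<le> r x" if "r \<in> C" for r x
        unfolding u_def by (rule cINF_lower[OF bdd that])
      have greatest: "k \<le> u x" if "\<And>r. r \<in> C \<Longrightarrow> k \<le> r x" for k x
        unfolding u_def using that False by (intro cINF_greatest) auto
      have "sublinear u"
      proof (rule sublinearI)
        fix x y
        \<comment> \<open>The smaller of the two functionals bounds both terms simultaneously.\<close>
        have *: "u (x + y) \<le> r x + s y" if rs: "r \<in> C" "s \<in> C" for r s
        proof -
          obtain t where t: "t \<in> C" "t \<le> r" "t \<le> s" using total[OF rs] rs by blast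
          have "u (x + y) \<le> t x + t y"
            using lower[OF t(1), of "x + y"] sublinear_add[of t x y] CS[OF t(1)]
            by (simp add: S_def)
          also have "\<dots> \<le> r x + s y" using t by (auto simp: le_fun_def intro: add_mono)
          finally show ?thesis .
        qed
        have "u (x + y) - r x \<le> u y" if "r \<in> C" for r
          by (rule greatest) (use *[OF that] in \<open>simp add: algebra_simps\<close>)
        then have "u (x + y) - u y \<le> u x"
          by (intro greatest) (simp add: algebra_simps)
        then show "u (x + y) \<le> u x + u y" by simp
      next
        fix c :: real and x
        assume c: "0 \<le> c"
        have *: "u (c *\<^sub>R x) \<le> c * r x" if "r \<in> C" for r
          using lower[OF that, of "c *\<^sub>R x"] sublinear_scale[OF _ c, of r x] CS[OF that]
          by (simp add: S_def)
        show "u (c *\<^sub>R x) \<le> c * u x"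
        proof (cases "c = 0")
          case True
          then show ?thesis using * False by auto
        next
          case False
          then have "u (c *\<^sub>R x) / c \<le> u x"
            using * c by (intro greatest) (simp add: field_simps)
          then show ?thesis using c False by (simp add: field_simps)
        qed
      qed
      moreover have "u \<le> q"
      proof -
        obtain r where "r \<in> C" using False by blast
        then have "u \<le> r" "r \<le> q" using lower CS by (auto simp: S_def le_fun_def)
        then show ?thesis by (rule order_trans)
      qed
      ultimately show ?thesis using lower by (auto simp: S_def le_fun_def)
    qed
  qed
  then obtain m where m: "m \<in> S" "\<And>s. s \<in> S \<Longrightarrow> s \<le> m \<Longrightarrow> s = m" by blast
  show thesis
  proof (rule that[of m])
    show "s = m" if "sublinear s" "s \<le> m" for s
      using that m by (auto simp: S_def intro: order_trans)
  qed (use m in \<open>auto simp: S_def\<close>)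
qed

text \<open>The smallest cone that contains the prescription \<open>(y, k)\<close>.\<close>

definition ray :: "'v::real_vector \<Rightarrow> real \<Rightarrow> ('v \<times> real) set" where
  "ray y k = (\<lambda>t. (t *\<^sub>R y, t * k)) ` {0..}"

lemma ray_zero: "(0, 0) \<in> ray y k"
  unfolding ray_def by (rule image_eqI[of _ _ 0]) simp_all

lemma ray_generator: "(y, k) \<in> ray y k"
  unfolding ray_def by (rule image_eqI[of _ _ 1]) simp_all

lemma ray_add:
  assumes "(v, a) \<in> ray y k" "(w, b) \<in> ray y k"
  shows "(v + w, a + b) \<in> ray y k"
proof -
  obtain s t where "0 \<le> s" "0 \<le> t" "v = s *\<^sub>R y" "a = s * k" "w = t *\<^sub>R y" "b = t * k"
    using assms by (auto simp: ray_def)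
  then show ?thesis
    unfolding ray_def by (intro image_eqI[of _ _ "s + t"]) (simp_all add: algebra_simps)
qed

lemma ray_scale:
  assumes "0 \<le> c" "(v, a) \<in> ray y k"
  shows "(c *\<^sub>R v, c * a) \<in> ray y k"
proof -
  obtain t where "0 \<le> t" "v = t *\<^sub>R y" "a = t * k"
    using assms by (auto simp: ray_def)
  then show ?thesis
    unfolding ray_def using assms(1) by (intro image_eqI[of _ _ "c * t"]) simp_all
qed

lemma ray_dominated:
  assumes "sublinear q" "k \<le> q y" "(v, a) \<in> ray y k"
  shows "a \<le> q v"
  using assms by (auto simp: ray_def sublinear_scale intro: mult_left_mono)

text \<open>A minimal \<open>r\<close> cannot be improved, so improving it along the ray through \<open>(y, r(y))\<close> changes
  nothing. That gives \<open>r(-y) \<le> -r(y)\<close>, and a sublinear odd functional is linear.\<close>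

lemma minimal_sublinear_imp_linear:
  fixes r :: "'v::real_vector \<Rightarrow> real"
  assumes r: "sublinear r" and min: "\<And>s. sublinear s \<Longrightarrow> s \<le> r \<Longrightarrow> s = r"
  shows "linear r"
proof -
  have neg: "r (- y) = - r y" for y
  proof -
    obtain s where s: "sublinear s" "\<And>x. s x \<le> r x" "\<And>v a. (v, a) \<in> ray y (r y) \<Longrightarrow> s (- v) \<le> - a"
      by (rule sublinear_improve_on_cone[OF r, of "ray y (r y)"])
        (blast intro: ray_zero ray_add ray_scale ray_dominated[OF r order_refl])+
    have "s = r" using s by (intro min) (auto simp: le_fun_def)
    then have "r (- y) \<le> - r y" using s(3)[OF ray_generator] by simp
    then show ?thesis using sublinear_minus[OF r, of y] by simp
  qed
  show ?thesis
  proof (rule linearI)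
    fix x y
    have "r x \<le> r (x + y) + r (- y)" using sublinear_add[OF r, of "x + y" "- y"] by simp
    then show "r (x + y) = r x + r y" using neg[of y] sublinear_add[OF r, of x y] by simp
  next
    fix c :: real and x
    show "r (c *\<^sub>R x) = c *\<^sub>R r x"
    proof (cases "0 \<le> c")
      case True
      then show ?thesis by (simp add: sublinear_scale[OF r])
    next
      case False
      then have "r ((- c) *\<^sub>R x) = - c * r x" by (intro sublinear_scale[OF r]) simp
      then show ?thesis using neg[of "c *\<^sub>R x"] by simp
    qed
  qed
qed

text \<open>The Hahn-Banach theorem for prescriptions on a cone. With \<open>G\<close> the graph of a linear
  functional on a subspace, applying the conclusion to \<open>v\<close> and \<open>-v\<close> shows that \<open>L\<close> extends it. As \<open>G\<close>
  is an arbitrary set of pairs, a family \<open>(S F, \<phi> F)\<close> can be used directly, even though it is not yet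
  known that \<open>\<phi> F\<close> is determined by \<open>S F\<close>.\<close>

theorem hahn_banach_cone:
  fixes q :: "'v::real_vector \<Rightarrow> real"
  assumes q: "sublinear q"
    and zero: "(0, 0) \<in> G"
    and add: "\<And>v a w b. (v, a) \<in> G \<Longrightarrow> (w, b) \<in> G \<Longrightarrow> (v + w, a + b) \<in> G"
    and scale: "\<And>c v a. 0 \<le> c \<Longrightarrow> (v, a) \<in> G \<Longrightarrow> (c *\<^sub>R v, c * a) \<in> G"
    and dom: "\<And>v a. (v, a) \<in> G \<Longrightarrow> a \<le> q v"
  obtains L where "linear L" "\<And>x. L x \<le> q x" "\<And>v a. (v, a) \<in> G \<Longrightarrow> a \<le> L v"
proof -
  obtain r where r: "sublinear r" "\<And>x. r x \<le> q x" "\<And>v a. (v, a) \<in> G \<Longrightarrow> r (- v) \<le> - a"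
    using sublinear_improve_on_cone[OF assms] by blast
  obtain L where L: "sublinear L" "L \<le> r" "\<And>s. sublinear s \<Longrightarrow> s \<le> L \<Longrightarrow> s = L"
    using minimal_sublinear_below[OF r(1)] by blast
  have lin: "linear L" by (rule minimal_sublinear_imp_linear[OF L(1,3)])
  have "L x \<le> q x" for x using L(2) r(2)[of x] by (auto simp: le_fun_def intro: order_trans)
  moreover have "a \<le> L v" if "(v, a) \<in> G" for v a
  proof -
    have "L (- v) \<le> r (- v)" using L(2) by (simp add: le_fun_def)
    then show ?thesis using r(3)[OF that] linear_neg[OF lin, of v] by simp
  qed
  ultimately show thesis using that lin by blast
qed

lemma norming_functional:
  fixes x :: "'a::real_normed_vector"
  obtains f :: "'a \<Rightarrow>\<^sub>L real" where "norm f \<le> 1" "blinfun_apply f x = norm x"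
proof -
  have q: "sublinear (norm :: 'a \<Rightarrow> real)"
    by (rule sublinearI) (simp_all add: norm_triangle_ineq)
  obtain L :: "'a \<Rightarrow> real" where L: "linear L" "\<And>y. L y \<le> norm y"
    "\<And>v a. (v, a) \<in> ray x (norm x) \<Longrightarrow> a \<le> L v"
    by (rule hahn_banach_cone[OF q, of "ray x (norm x)"])
      (blast intro: ray_zero ray_add ray_scale ray_dominated[OF q order_refl])+
  have abs: "\<bar>L y\<bar> \<le> norm y" for y
    using L(2)[of y] L(2)[of "- y"] linear_neg[OF L(1), of y] by (simp add: abs_le_iff)
  have bl: "bounded_linear L"
    using L(1) abs by (intro bounded_linear.intro) (auto simp: bounded_linear_axioms_def intro!: exI[of _ 1])
  have "norm x \<le> L x" by (rule L(3)[OF ray_generator])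
  then have "L x = norm x" using L(2)[of x] by simp
  then show thesis
    using abs bl by (intro that[of "Blinfun L"] norm_blinfun_bound) (auto simp: bounded_linear_Blinfun_apply)
qed

section \<open>Averages and norms on finite probability spaces\<close>

definition avg :: "'w set \<Rightarrow> ('w \<Rightarrow> real) \<Rightarrow> real" where
  "avg \<Omega> f = (\<Sum>\<omega>\<in>\<Omega>. f \<omega>) / real (card \<Omega>)"

lemma avg_mono: "(\<And>\<omega>. \<omega> \<in> \<Omega> \<Longrightarrow> f \<omega> \<le> g \<omega>) \<Longrightarrow> avg \<Omega> f \<le> avg \<Omega> g"
  unfolding avg_def by (intro divide_right_mono sum_mono) auto

lemma avg_cong: "(\<And>\<omega>. \<omega> \<in> \<Omega> \<Longrightarrow> f \<omega> = g \<omega>) \<Longrightarrow> avg \<Omega> f = avg \<Omega> g"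
  unfolding avg_def by (simp cong: sum.cong)

lemma avg_nonneg: "(\<And>\<omega>. \<omega> \<in> \<Omega> \<Longrightarrow> 0 \<le> f \<omega>) \<Longrightarrow> 0 \<le> avg \<Omega> f"
  unfolding avg_def by (intro divide_nonneg_nonneg sum_nonneg) auto

lemma avg_add: "avg \<Omega> (\<lambda>\<omega>. f \<omega> + g \<omega>) = avg \<Omega> f + avg \<Omega> g"
  by (simp add: avg_def sum.distrib add_divide_distrib)

lemma avg_mult_left: "avg \<Omega> (\<lambda>\<omega>. c * f \<omega>) = c * avg \<Omega> f"
  by (simp add: avg_def sum_distrib_left)

lemma avg_eq_0_iff:
  assumes "finite \<Omega>" "\<And>\<omega>. \<omega> \<in> \<Omega> \<Longrightarrow> 0 \<le> f \<omega>"
  shows "avg \<Omega> f = 0 \<longleftrightarrow> (\<forall>\<omega>\<in>\<Omega>. f \<omega> = 0)"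
  using assms by (auto simp: avg_def sum_nonneg_eq_0_iff)

lemma Lr_norm_ereal:
  "Lr_norm (ereal r) \<Omega> F = avg \<Omega> (\<lambda>\<omega>. norm (F \<omega>) powr r) powr (1 / r)"
  by (simp add: Lr_norm_def avg_def)

lemma Lr_norm_1: "Lr_norm (ereal 1) \<Omega> F = avg \<Omega> (\<lambda>\<omega>. norm (F \<omega>))"
  by (simp add: Lr_norm_ereal avg_nonneg)

lemma Lr_norm_infinity: "Lr_norm \<infinity> \<Omega> F = Max ((\<lambda>\<omega>. norm (F \<omega>)) ` \<Omega>)"
  by (simp add: Lr_norm_def)

lemma norm_le_Lr_norm_infinity:
  "finite \<Omega> \<Longrightarrow> \<omega> \<in> \<Omega> \<Longrightarrow> norm (F \<omega>) \<le> Lr_norm \<infinity> \<Omega> F"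
  by (simp add: Lr_norm_infinity)

lemma Lr_norm_infinity_le:
  "finite \<Omega> \<Longrightarrow> \<Omega> \<noteq> {} \<Longrightarrow> (\<And>\<omega>. \<omega> \<in> \<Omega> \<Longrightarrow> norm (F \<omega>) \<le> K) \<Longrightarrow> Lr_norm \<infinity> \<Omega> F \<le> K"
  by (simp add: Lr_norm_infinity)

lemma Lr_norm_ereal_powr:
  "0 < r \<Longrightarrow> Lr_norm (ereal r) \<Omega> F powr r = avg \<Omega> (\<lambda>\<omega>. norm (F \<omega>) powr r)"
  by (simp add: Lr_norm_ereal powr_powr avg_nonneg)

lemma Lr_norm_cong:
  assumes "\<And>\<omega>. \<omega> \<in> \<Omega> \<Longrightarrow> norm (F \<omega>) = norm (G \<omega>)"
  shows "Lr_norm r \<Omega> F = Lr_norm r \<Omega> G"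
proof -
  have "(\<lambda>\<omega>. norm (F \<omega>)) ` \<Omega> = (\<lambda>\<omega>. norm (G \<omega>)) ` \<Omega>"
    using assms by (simp cong: image_cong)
  then show ?thesis using assms by (simp add: Lr_norm_def cong: sum.cong)
qed

text \<open>The identities \<open>p (q - 1) = q\<close> and \<open>q (p - 1) = p\<close> are what makes the weights
  \<open>\<parallel>F\<parallel>\<^sup>p\<^sup>-\<^sup>1\<close> and \<open>\<parallel>g\<parallel>\<^sup>q\<^sup>-\<^sup>1\<close> extremal in the Hoelder inequality.\<close>

lemma conj_exponent_cases:
  assumes "1 \<le> p"
  obtains "p = 1" "conj_exponent p = \<infinity>"
  | q where "1 < p" "1 < q" "1 / p + 1 / q = 1" "p * (q - 1) = q" "q * (p - 1) = p" "conj_exponent p = ereal q"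
proof (cases "p = 1")
  case True
  then show thesis using that(1) by (simp add: conj_exponent_def)
next
  case False
  then have "1 < p" using assms by simp
  then show thesis
    using that(2)[of "p / (p - 1)"] by (simp add: conj_exponent_def field_simps)
qed

lemma Lr_norm_nonneg:
  assumes "finite \<Omega>" "\<Omega> \<noteq> {}"
  shows "0 \<le> Lr_norm r \<Omega> F"
proof (cases "r = \<infinity>")
  case True
  obtain \<omega> where "\<omega> \<in> \<Omega>" using assms by blast
  then have "norm (F \<omega>) \<le> Lr_norm r \<Omega> F"
    using norm_le_Lr_norm_infinity[OF assms(1)] True by simp
  then show ?thesis using norm_ge_zero order_trans by blast
qed (simp add: Lr_norm_def)

lemma Lr_norm_eq_0_iff:
  assumes "finite \<Omega>" "\<Omega> \<noteq> {}" "1 \<le> r"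
  shows "Lr_norm r \<Omega> F = 0 \<longleftrightarrow> (\<forall>\<omega>\<in>\<Omega>. F \<omega> = 0)"
proof (cases r)
  case (real s)
  then show ?thesis using assms by (auto simp: Lr_norm_ereal avg_eq_0_iff)
next
  case PInf
  have "Lr_norm r \<Omega> F = 0 \<longleftrightarrow> Lr_norm r \<Omega> F \<le> 0"
    using Lr_norm_nonneg[OF assms(1,2), of r F] by auto
  also have "\<dots> \<longleftrightarrow> (\<forall>\<omega>\<in>\<Omega>. F \<omega> = 0)"
    using assms PInf by (simp add: Lr_norm_infinity)
  finally show ?thesis .
qed (use assms in auto)

lemma conj_exponent_ge_1: "1 \<le> p \<Longrightarrow> 1 \<le> conj_exponent p"
  by (erule conj_exponent_cases) auto

lemma Lr_norm_scaleR:
  assumes "0 < r"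
  shows "Lr_norm (ereal r) \<Omega> (\<lambda>\<omega>. c *\<^sub>R F \<omega>) = \<bar>c\<bar> * Lr_norm (ereal r) \<Omega> F"
proof -
  have "avg \<Omega> (\<lambda>\<omega>. norm (c *\<^sub>R F \<omega>) powr r) = \<bar>c\<bar> powr r * avg \<Omega> (\<lambda>\<omega>. norm (F \<omega>) powr r)"
    by (simp add: powr_mult avg_mult_left)
  then show ?thesis
    using assms by (simp add: Lr_norm_ereal powr_mult powr_powr avg_nonneg)
qed

section \<open>Duality between the p-norm and the conjugate norm\<close>

definition pairing :: "'w set \<Rightarrow> ('w \<Rightarrow> 'a::real_normed_vector) \<Rightarrow> ('w \<Rightarrow> 'a \<Rightarrow>\<^sub>L real) \<Rightarrow> real" where
  "pairing \<Omega> F g = avg \<Omega> (\<lambda>\<omega>. blinfun_apply (g \<omega>) (F \<omega>))"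

lemma pairing_le_avg_norms: "pairing \<Omega> F g \<le> avg \<Omega> (\<lambda>\<omega>. norm (F \<omega>) * norm (g \<omega>))"
  unfolding pairing_def
proof (rule avg_mono)
  fix \<omega>
  show "blinfun_apply (g \<omega>) (F \<omega>) \<le> norm (F \<omega>) * norm (g \<omega>)"
    using norm_blinfun[of "g \<omega>" "F \<omega>"] by (simp add: mult.commute)
qed

text \<open>Young's inequality for \<open>a/A\<close> and \<open>b/B\<close>, averaged, where \<open>A\<close> and \<open>B\<close> are the two norms. If one of
  these is zero, the corresponding function vanishes on \<open>\<Omega>\<close>.\<close>

lemma holder_avg:
  assumes pq: "1 < p" "1 < q" "1 / p + 1 / q = 1" and fin: "finite \<Omega>"
    and a: "\<And>\<omega>. \<omega> \<in> \<Omega> \<Longrightarrow> 0 \<le> a \<omega>" and b: "\<And>\<omega>. \<omega> \<in> \<Omega> \<Longrightarrow> 0 \<le> b \<omega>"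
  shows "avg \<Omega> (\<lambda>\<omega>. a \<omega> * b \<omega>)
    \<le> avg \<Omega> (\<lambda>\<omega>. a \<omega> powr p) powr (1 / p) * avg \<Omega> (\<lambda>\<omega>. b \<omega> powr q) powr (1 / q)"
proof -
  define A where "A = avg \<Omega> (\<lambda>\<omega>. a \<omega> powr p) powr (1 / p)"
  define B where "B = avg \<Omega> (\<lambda>\<omega>. b \<omega> powr q) powr (1 / q)"
  have Ap: "A powr p = avg \<Omega> (\<lambda>\<omega>. a \<omega> powr p)" and Bq: "B powr q = avg \<Omega> (\<lambda>\<omega>. b \<omega> powr q)"
    using pq by (simp_all add: A_def B_def powr_powr avg_nonneg)
  show ?thesis
  proof (cases "A = 0 \<or> B = 0")
    case True
    then have "(\<forall>\<omega>\<in>\<Omega>. a \<omega> = 0) \<or> (\<forall>\<omega>\<in>\<Omega>. b \<omega> = 0)"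
      by (auto simp: A_def B_def avg_eq_0_iff[OF fin])
    then have "avg \<Omega> (\<lambda>\<omega>. a \<omega> * b \<omega>) = avg \<Omega> (\<lambda>_. 0)"
      by (intro avg_cong) auto
    also have "\<dots> = 0" by (simp add: avg_def)
    finally show ?thesis by simp
  next
    case False
    then have AB: "0 < A" "0 < B" by (auto simp: A_def B_def)
    have "avg \<Omega> (\<lambda>\<omega>. a \<omega> * b \<omega>)
        \<le> avg \<Omega> (\<lambda>\<omega>. (A * B) * (inverse (p * A powr p) * a \<omega> powr p + inverse (q * B powr q) * b \<omega> powr q))"
    proof (rule avg_mono)
      fix \<omega> assume w: "\<omega> \<in> \<Omega>"
      have "(a \<omega> / A) * (b \<omega> / B) \<le> (a \<omega> / A) powr p / p + (b \<omega> / B) powr q / q"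
        using a[OF w] b[OF w] AB by (intro Youngs_inequality pq) auto
      also have "\<dots> = inverse (p * A powr p) * a \<omega> powr p + inverse (q * B powr q) * b \<omega> powr q"
        using a[OF w] b[OF w] AB by (simp add: powr_divide field_simps)
      finally have "(A * B) * ((a \<omega> / A) * (b \<omega> / B)) \<le> (A * B) * \<dots>"
        using AB by (intro mult_left_mono) auto
      then show "a \<omega> * b \<omega> \<le> (A * B) * (inverse (p * A powr p) * a \<omega> powr p + inverse (q * B powr q) * b \<omega> powr q)"
        using AB by simp
    qed
    also have "\<dots> = (A * B) * (1 / p + 1 / q)"
      unfolding avg_mult_left avg_add Ap[symmetric] Bq[symmetric] using AB pq
      by (simp add: field_simps)
    finally show ?thesis using pq by (simp add: A_def B_def)
  qed
qed

lemma holder_pairing: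
  assumes p: "1 \<le> p" and fin: "finite \<Omega>"
  shows "pairing \<Omega> F g \<le> Lr_norm (ereal p) \<Omega> F * Lr_norm (conj_exponent p) \<Omega> g"
  using p
proof (cases rule: conj_exponent_cases)
  case 1
  have "avg \<Omega> (\<lambda>\<omega>. norm (F \<omega>) * norm (g \<omega>)) \<le> avg \<Omega> (\<lambda>\<omega>. Lr_norm \<infinity> \<Omega> g * norm (F \<omega>))"
    by (rule avg_mono) (simp add: mult.commute mult_left_mono norm_le_Lr_norm_infinity[OF fin])
  then show ?thesis
    using pairing_le_avg_norms[of \<Omega> F g] unfolding avg_mult_left
    unfolding 1(2) unfolding 1(1) Lr_norm_1 by (simp add: mult.commute)
next
  case (2 q)
  show ?thesis
    using pairing_le_avg_norms[of \<Omega> F g]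
      holder_avg[OF 2(1,2,3) fin, of "\<lambda>\<omega>. norm (F \<omega>)" "\<lambda>\<omega>. norm (g \<omega>)"]
    by (simp add: 2(6) Lr_norm_ereal)
qed

text \<open>Take a norming functional \<open>f\<^sub>\<omega>\<close> of each value \<open>F(\<omega>)\<close> and weight it by the extremal function of the
  scalar Hoelder inequality, \<open>(\<parallel>F(\<omega>)\<parallel> / \<parallel>F\<parallel>\<^sub>p)\<^sup>p\<^sup>-\<^sup>1\<close>; for \<open>p = 1\<close> the weight is constant.\<close>

lemma norming_dual_element:
  fixes F :: "'w \<Rightarrow> 'a::real_normed_vector"
  assumes p: "1 \<le> p" and fin: "finite \<Omega>" "\<Omega> \<noteq> {}"
  obtains g :: "'w \<Rightarrow> 'a \<Rightarrow>\<^sub>L real"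
  where "pairing \<Omega> F g = Lr_norm (ereal p) \<Omega> F" "Lr_norm (conj_exponent p) \<Omega> g \<le> 1"
proof -
  have "\<forall>\<omega>. \<exists>f :: 'a \<Rightarrow>\<^sub>L real. norm f \<le> 1 \<and> blinfun_apply f (F \<omega>) = norm (F \<omega>)"
    by (metis norming_functional)
  then obtain f :: "'w \<Rightarrow> 'a \<Rightarrow>\<^sub>L real"
    where f: "\<And>\<omega>. norm (f \<omega>) \<le> 1" "\<And>\<omega>. blinfun_apply (f \<omega>) (F \<omega>) = norm (F \<omega>)"
    by metis
  from p show thesis
  proof (cases rule: conj_exponent_cases)
    case 1
    show thesis
    proof (rule that[of f])
      show "pairing \<Omega> F f = Lr_norm (ereal p) \<Omega> F"
        by (simp only: 1(1) Lr_norm_1 pairing_def f(2))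
      show "Lr_norm (conj_exponent p) \<Omega> f \<le> 1"
        unfolding 1(2) by (rule Lr_norm_infinity_le[OF fin f(1)])
    qed
  next
    case (2 q)
    define A where "A = Lr_norm (ereal p) \<Omega> F"
    have Ap: "A powr p = avg \<Omega> (\<lambda>\<omega>. norm (F \<omega>) powr p)"
      unfolding A_def using 2 by (intro Lr_norm_ereal_powr) simp
    show thesis
    proof (cases "A = 0")
      case True
      show thesis
      proof (rule that[of "\<lambda>_. 0"])
        show "pairing \<Omega> F (\<lambda>_. 0) = Lr_norm (ereal p) \<Omega> F"
          using True by (simp add: pairing_def A_def avg_def)
        have "Lr_norm (conj_exponent p) \<Omega> (\<lambda>_. 0 :: 'a \<Rightarrow>\<^sub>L real) = 0"
          by (subst Lr_norm_eq_0_iff[OF fin conj_exponent_ge_1[OF p]]) simp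
        then show "Lr_norm (conj_exponent p) \<Omega> (\<lambda>_. 0 :: 'a \<Rightarrow>\<^sub>L real) \<le> 1" by simp
      qed
    next
      case False
      then have A: "0 < A" using Lr_norm_nonneg[OF fin, of "ereal p" F] by (simp add: A_def)
      define c where "c \<omega> = (norm (F \<omega>) / A) powr (p - 1)" for \<omega>
      have "pairing \<Omega> F (\<lambda>\<omega>. c \<omega> *\<^sub>R f \<omega>) = avg \<Omega> (\<lambda>\<omega>. A powr (1 - p) * norm (F \<omega>) powr p)"
        unfolding pairing_def
      proof (rule avg_cong)
        fix \<omega>
        have "norm (F \<omega>) powr (p - 1) * norm (F \<omega>) = norm (F \<omega>) powr p"
          using powr_mult_base[of "norm (F \<omega>)" "p - 1"] by (simp add: mult.commute)
        moreover have "inverse (A powr (p - 1)) = A powr (1 - p)"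
          by (simp flip: powr_minus)
        ultimately have "(norm (F \<omega>) powr (p - 1) / A powr (p - 1)) * norm (F \<omega>) = A powr (1 - p) * norm (F \<omega>) powr p"
          by (simp only: divide_inverse) (simp add: mult.left_commute)
        then show "blinfun_apply (c \<omega> *\<^sub>R f \<omega>) (F \<omega>) = A powr (1 - p) * norm (F \<omega>) powr p"
          using A by (simp add: c_def scaleR_blinfun.rep_eq f powr_divide)
      qed
      also have "\<dots> = A"
        using A by (simp add: avg_mult_left flip: Ap powr_add)
      finally have pair: "pairing \<Omega> F (\<lambda>\<omega>. c \<omega> *\<^sub>R f \<omega>) = Lr_norm (ereal p) \<Omega> F"
        by (simp add: A_def)
      have "avg \<Omega> (\<lambda>\<omega>. norm (c \<omega> *\<^sub>R f \<omega>) powr q)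
          \<le> avg \<Omega> (\<lambda>\<omega>. inverse (A powr p) * norm (F \<omega>) powr p)"
      proof (rule avg_mono)
        fix \<omega>
        have "norm (c \<omega> *\<^sub>R f \<omega>) powr q \<le> c \<omega> powr q"
          using 2 f(1)[of \<omega>] by (intro powr_mono2) (auto simp: c_def intro: mult_left_le)
        also have "\<dots> = (norm (F \<omega>) / A) powr p"
          using 2(5) by (simp add: c_def powr_powr mult.commute)
        also have "\<dots> = inverse (A powr p) * norm (F \<omega>) powr p"
          using A powr_divide[of "norm (F \<omega>)" A p] by (simp add: divide_inverse mult.commute)
        finally show "norm (c \<omega> *\<^sub>R f \<omega>) powr q \<le> inverse (A powr p) * norm (F \<omega>) powr p" .
      qed
      also have "\<dots> = 1" using A by (simp add: avg_mult_left flip: Ap)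
      finally have "Lr_norm (ereal q) \<Omega> (\<lambda>\<omega>. c \<omega> *\<^sub>R f \<omega>) \<le> 1"
        using 2 by (simp add: Lr_norm_ereal avg_nonneg powr_le1)
      then show thesis using pair 2 by (intro that) auto
    qed
  qed
qed

lemma pairing_add_left: "pairing \<Omega> (F + G) g = pairing \<Omega> F g + pairing \<Omega> G g"
  by (simp add: pairing_def blinfun.add_right avg_add)

lemma pairing_scaleR_left: "pairing \<Omega> (c *\<^sub>R F) g = c * pairing \<Omega> F g"
  by (simp add: pairing_def blinfun.scaleR_right avg_mult_left)

text \<open>Minkowski's inequality comes from duality: \<open>\<parallel>F + G\<parallel> = \<langle>F + G, g\<rangle> = \<langle>F, g\<rangle> + \<langle>G, g\<rangle> \<le> \<parallel>F\<parallel> + \<parallel>G\<parallel>\<close> for an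
  element \<open>g\<close> of the dual unit ball that norms \<open>F + G\<close>.\<close>

lemma sublinear_Lr_norm:
  assumes p: "1 \<le> p" and fin: "finite \<Omega>" "\<Omega> \<noteq> {}"
  shows "sublinear (Lr_norm (ereal p) \<Omega> :: ('w \<Rightarrow> 'a::real_normed_vector) \<Rightarrow> real)"
proof (rule sublinearI)
  fix F G :: "'w \<Rightarrow> 'a"
  obtain g :: "'w \<Rightarrow> 'a \<Rightarrow>\<^sub>L real" where g: "pairing \<Omega> (F + G) g = Lr_norm (ereal p) \<Omega> (F + G)"
    "Lr_norm (conj_exponent p) \<Omega> g \<le> 1"
    using norming_dual_element[OF assms] by blast
  have *: "pairing \<Omega> H g \<le> Lr_norm (ereal p) \<Omega> H" for H
  proof -
    have "pairing \<Omega> H g \<le> Lr_norm (ereal p) \<Omega> H * Lr_norm (conj_exponent p) \<Omega> g"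
      by (rule holder_pairing[OF p fin(1)])
    also have "\<dots> \<le> Lr_norm (ereal p) \<Omega> H * 1"
      by (rule mult_left_mono[OF g(2) Lr_norm_nonneg[OF fin]])
    finally show ?thesis by simp
  qed
  show "Lr_norm (ereal p) \<Omega> (F + G) \<le> Lr_norm (ereal p) \<Omega> F + Lr_norm (ereal p) \<Omega> G"
    using *[of F] *[of G] by (simp add: pairing_add_left flip: g(1))
next
  fix c :: real and F :: "'w \<Rightarrow> 'a"
  assume "0 \<le> c"
  then show "Lr_norm (ereal p) \<Omega> (c *\<^sub>R F) \<le> c * Lr_norm (ereal p) \<Omega> F"
    using Lr_norm_scaleR[of p \<Omega> c F] p by (simp add: scaleR_fun_def)
qed

text \<open>Otherwise \<open>t \<parallel>f\<parallel> < \<parallel>f\<parallel>\<close> would be a bound for \<open>f\<close> on the unit ball.\<close>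

lemma blinfun_almost_attains_norm:
  fixes f :: "'a::real_normed_vector \<Rightarrow>\<^sub>L real"
  assumes t: "t < 1"
  obtains v where "norm v \<le> 1" "t * norm f \<le> blinfun_apply f v"
proof (cases "\<exists>v. norm v \<le> 1 \<and> t * norm f \<le> blinfun_apply f v")
  case False
  then have small: "blinfun_apply f v < t * norm f" if "norm v \<le> 1" for v
    using that not_le by blast
  have pos: "0 < t * norm f"
    using small[of 0] by (simp add: blinfun.zero_right)
  have "norm f \<le> t * norm f"
  proof (rule norm_blinfun_bound)
    show "0 \<le> t * norm f" using pos by simp
    fix x
    show "norm (blinfun_apply f x) \<le> t * norm f * norm x"
    proof (cases "x = 0")
      case False
      then have n: "norm (x /\<^sub>R norm x) \<le> 1" "norm (- (x /\<^sub>R norm x)) \<le> 1" by simp_all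
      have "\<bar>blinfun_apply f (x /\<^sub>R norm x)\<bar> \<le> t * norm f"
        using small[OF n(1)] small[OF n(2)] by (simp add: blinfun.minus_right)
      then have "\<bar>blinfun_apply f x\<bar> / norm x \<le> t * norm f"
        by (simp add: blinfun.scaleR_right abs_mult divide_inverse mult.commute)
      then show ?thesis using False by (simp add: pos_divide_le_eq)
    qed (simp add: blinfun.zero_right)
  qed
  moreover have "0 < norm f" using pos by (cases "norm f = 0") auto
  ultimately show thesis using t by simp
qed (use that in blast)

text \<open>The functionals \<open>g(\<omega>)\<close> need not attain their norms, so each is first tested on a vector of the
  unit ball where it attains the fraction \<open>t < 1\<close> of its norm. Letting \<open>t\<close> tend to 1 reduces the claim to
  the scalar function \<open>\<parallel>g\<parallel>\<close> and nonnegative scalar weights \<open>b\<close> (the fact \<open>weighted\<close>). The weights that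
  give the result are the indicator of one point for \<open>p = 1\<close>, and \<open>\<parallel>g\<parallel>\<^sup>q\<^sup>-\<^sup>1\<close> otherwise.\<close>

lemma Lr_norm_dual_le:
  fixes g :: "'w \<Rightarrow> 'a::real_normed_vector \<Rightarrow>\<^sub>L real"
  assumes p: "1 \<le> p" and fin: "finite \<Omega>" "\<Omega> \<noteq> {}" and K: "0 \<le> K"
    and bound: "\<And>F. pairing \<Omega> F g \<le> K * Lr_norm (ereal p) \<Omega> F"
  shows "Lr_norm (conj_exponent p) \<Omega> g \<le> K"
proof -
  have weighted: "avg \<Omega> (\<lambda>\<omega>. b \<omega> * norm (g \<omega>)) \<le> K * Lr_norm (ereal p) \<Omega> b"
    if b: "\<And>\<omega>. 0 \<le> b \<omega>" for b :: "'w \<Rightarrow> real"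
  proof (rule field_le_mult_one_interval)
    fix t :: real assume t: "0 < t" "t < 1"
    have "\<exists>v. norm v \<le> 1 \<and> t * norm (g \<omega>) \<le> blinfun_apply (g \<omega>) v" for \<omega>
      using blinfun_almost_attains_norm[OF t(2)] by blast
    then obtain v where v: "\<And>\<omega>. norm (v \<omega>) \<le> 1" "\<And>\<omega>. t * norm (g \<omega>) \<le> blinfun_apply (g \<omega>) (v \<omega>)"
      by metis
    have "t * avg \<Omega> (\<lambda>\<omega>. b \<omega> * norm (g \<omega>)) \<le> pairing \<Omega> (\<lambda>\<omega>. b \<omega> *\<^sub>R v \<omega>) g"
      unfolding pairing_def avg_mult_left[symmetric]
    proof (rule avg_mono)
      fix \<omega>
      show "t * (b \<omega> * norm (g \<omega>)) \<le> blinfun_apply (g \<omega>) (b \<omega> *\<^sub>R v \<omega>)"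
        using mult_left_mono[OF v(2) b, of \<omega>]
        by (simp add: blinfun.scaleR_right algebra_simps)
    qed
    also have "\<dots> \<le> K * Lr_norm (ereal p) \<Omega> (\<lambda>\<omega>. b \<omega> *\<^sub>R v \<omega>)" by (rule bound)
    also have "\<dots> \<le> K * Lr_norm (ereal p) \<Omega> b"
      unfolding Lr_norm_ereal using p b v(1)
      by (intro mult_left_mono[OF _ K] powr_mono2 avg_mono avg_nonneg) (auto intro: mult_left_le)
    finally show "t * avg \<Omega> (\<lambda>\<omega>. b \<omega> * norm (g \<omega>)) \<le> K * Lr_norm (ereal p) \<Omega> b" .
  qed
  from p show ?thesis
  proof (cases rule: conj_exponent_cases)
    case 1
    have "norm (g \<omega>) \<le> K" if w: "\<omega> \<in> \<Omega>" for \<omega>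
    proof -
      have "avg \<Omega> (\<lambda>\<nu>. indicator {\<omega>} \<nu> * norm (g \<nu>)) \<le> K * avg \<Omega> (indicator {\<omega>})"
        using weighted[of "indicator {\<omega>}"] unfolding 1 Lr_norm_1 by simp
      then have "norm (g \<omega>) / card \<Omega> \<le> K / card \<Omega>"
        using w fin by (simp add: avg_def sum_indicator_eq_card indicator_def if_distrib cong: if_cong)
      then show ?thesis using fin by (simp add: divide_le_cancel card_gt_0_iff)
    qed
    then show ?thesis unfolding 1(2) by (rule Lr_norm_infinity_le[OF fin])
  next
    case (2 q)
    define S where "S = avg \<Omega> (\<lambda>\<omega>. norm (g \<omega>) powr q)"
    have norm: "Lr_norm (conj_exponent p) \<Omega> g = S powr (1 / q)"
      by (simp add: 2(6) Lr_norm_ereal S_def)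
    show ?thesis
    proof (cases "S = 0")
      case True
      then show ?thesis using K norm by simp
    next
      case False
      then have S: "0 < S" using avg_nonneg[of \<Omega> "\<lambda>\<omega>. norm (g \<omega>) powr q"] by (simp add: S_def)
      have "avg \<Omega> (\<lambda>\<omega>. norm (g \<omega>) powr (q - 1) * norm (g \<omega>)) = S"
        unfolding S_def
        by (rule avg_cong) (use powr_mult_base[of "norm (g _)" "q - 1"] in \<open>simp add: mult.commute\<close>)
      moreover have "Lr_norm (ereal p) \<Omega> (\<lambda>\<omega>. norm (g \<omega>) powr (q - 1)) = S powr (1 / p)"
        using 2(4) by (simp add: Lr_norm_ereal S_def powr_powr mult.commute)
      ultimately have "S \<le> K * S powr (1 / p)"
        using weighted[of "\<lambda>\<omega>. norm (g \<omega>) powr (q - 1)"] by simp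
      moreover have "S = S powr (1 / q) * S powr (1 / p)"
        using S 2(3) by (simp add: add.commute flip: powr_add)
      ultimately have "S powr (1 / q) * S powr (1 / p) \<le> K * S powr (1 / p)" by simp
      then show ?thesis using S norm by simp
    qed
  qed
qed

definition point_mass :: "'w \<Rightarrow> 'a::zero \<Rightarrow> 'w \<Rightarrow> 'a" where
  "point_mass \<omega> v = (\<lambda>\<nu>. if \<nu> = \<omega> then v else 0)"

lemma Lr_norm_point_mass:
  assumes "finite \<Omega>" "\<omega> \<in> \<Omega>" "1 \<le> p"
  shows "Lr_norm (ereal p) \<Omega> (point_mass \<omega> v) = (1 / card \<Omega>) powr (1 / p) * norm v"
proof -
  have "avg \<Omega> (\<lambda>\<nu>. norm (point_mass \<omega> v \<nu>) powr p) = (1 / card \<Omega>) * norm v powr p"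
    using assms by (simp add: avg_def point_mass_def if_distrib[of norm]
        if_distrib[of "\<lambda>t. t powr p"] cong: if_cong)
  then have "Lr_norm (ereal p) \<Omega> (point_mass \<omega> v) = ((1 / card \<Omega>) * norm v powr p) powr (1 / p)"
    by (simp only: Lr_norm_ereal)
  also have "\<dots> = (1 / card \<Omega>) powr (1 / p) * (norm v powr p) powr (1 / p)"
    by (rule powr_mult)
  finally show ?thesis using assms by (simp add: powr_powr)
qed

lemma pairing_point_mass:
  assumes "finite \<Omega>" "\<omega> \<in> \<Omega>"
  shows "pairing \<Omega> (point_mass \<omega> v) g = blinfun_apply (g \<omega>) v / card \<Omega>"
proof -
  have "blinfun_apply (g \<nu>) (point_mass \<omega> v \<nu>) = (if \<nu> = \<omega> then blinfun_apply (g \<omega>) v else 0)" for \<nu>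
    by (simp add: point_mass_def)
  then show ?thesis using assms by (simp add: pairing_def avg_def)
qed

lemma pairing_separates:
  assumes fin: "finite \<Omega>" and eq: "\<And>F. pairing \<Omega> F g = pairing \<Omega> F h" and w: "\<omega> \<in> \<Omega>"
  shows "g \<omega> = h \<omega>"
proof (rule blinfun_eqI)
  fix v
  have "0 < card \<Omega>" using fin w by (auto simp: card_gt_0_iff)
  then show "blinfun_apply (g \<omega>) v = blinfun_apply (h \<omega>) v"
    using eq[of "point_mass \<omega> v"] by (simp add: pairing_point_mass[OF fin w])
qed

lemma sum_fun_apply: "(\<Sum>i\<in>I. f i) x = (\<Sum>i\<in>I. f i x)"
  by (induction I rule: infinite_finite_induct) auto

text \<open>A function on the finite set \<open>\<Omega>\<close> is the sum of point masses up to a function vanishing on \<open>\<Omega>\<close>,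
  which the bound forces into the kernel of \<open>\<phi>\<close>. Hence \<open>g(\<omega>)\<close> has to be
  \<open>v \<mapsto> |\<Omega>| \<phi>(v \<delta>\<^sub>\<omega>)\<close>, the factor \<open>|\<Omega>|\<close> undoing the normalization of the pairing.\<close>

lemma Lr_dual_representation:
  fixes \<phi> :: "('w \<Rightarrow> 'a::real_normed_vector) \<Rightarrow> real"
  assumes p: "1 \<le> p" and fin: "finite \<Omega>" "\<Omega> \<noteq> {}" and K: "0 \<le> K"
    and lin: "linear \<phi>" and bound: "\<And>F. \<phi> F \<le> K * Lr_norm (ereal p) \<Omega> F"
  obtains g :: "'w \<Rightarrow> 'a \<Rightarrow>\<^sub>L real"
  where "\<And>F. \<phi> F = pairing \<Omega> F g" "Lr_norm (conj_exponent p) \<Omega> g \<le> K"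
proof -
  have abs: "\<bar>\<phi> F\<bar> \<le> K * Lr_norm (ereal p) \<Omega> F" for F
  proof -
    have "Lr_norm (ereal p) \<Omega> (- F) = Lr_norm (ereal p) \<Omega> F"
      by (rule Lr_norm_cong) simp
    then show ?thesis using bound[of F] bound[of "- F"] linear_neg[OF lin, of F] by simp
  qed
  define g where "g \<omega> = Blinfun (\<lambda>v. card \<Omega> * \<phi> (point_mass \<omega> v))" for \<omega>
  have g: "blinfun_apply (g \<omega>) v = card \<Omega> * \<phi> (point_mass \<omega> v)" if w: "\<omega> \<in> \<Omega>" for \<omega> v
  proof -
    have "bounded_linear (\<lambda>v. card \<Omega> * \<phi> (point_mass \<omega> v))"
    proof (rule bounded_linear_intro[where K = "card \<Omega> * (K * (1 / card \<Omega>) powr (1 / p))"])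
      fix u v :: 'a and c :: real
      have "point_mass \<omega> (u + v) = point_mass \<omega> u + point_mass \<omega> v"
        by (auto simp: point_mass_def fun_eq_iff)
      then show "card \<Omega> * \<phi> (point_mass \<omega> (u + v))
          = card \<Omega> * \<phi> (point_mass \<omega> u) + card \<Omega> * \<phi> (point_mass \<omega> v)"
        using linear_add[OF lin] by (simp add: distrib_left)
      have "point_mass \<omega> (c *\<^sub>R v) = c *\<^sub>R point_mass \<omega> v"
        by (auto simp: point_mass_def fun_eq_iff)
      then show "card \<Omega> * \<phi> (point_mass \<omega> (c *\<^sub>R v)) = c *\<^sub>R (card \<Omega> * \<phi> (point_mass \<omega> v))"
        using linear_scale[OF lin] by simp
      show "norm (card \<Omega> * \<phi> (point_mass \<omega> v)) \<le> norm v * (card \<Omega> * (K * (1 / card \<Omega>) powr (1 / p)))"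
        using mult_left_mono[OF abs[of "point_mass \<omega> v"], of "card \<Omega>"]
        by (simp add: Lr_norm_point_mass[OF fin(1) w p] abs_mult algebra_simps)
    qed
    then show ?thesis by (simp add: g_def bounded_linear_Blinfun_apply)
  qed
  have eq: "\<phi> F = pairing \<Omega> F g" for F
  proof -
    define R where "R = F - (\<Sum>\<omega>\<in>\<Omega>. point_mass \<omega> (F \<omega>))"
    have "R \<omega> = 0" if "\<omega> \<in> \<Omega>" for \<omega>
      using fin that by (simp add: R_def sum_fun_apply point_mass_def)
    then have "Lr_norm (ereal p) \<Omega> R = 0"
      using Lr_norm_eq_0_iff[OF fin, of "ereal p" R] p by simp
    then have "\<phi> R = 0" using abs[of R] by simp
    then have "\<phi> F = (\<Sum>\<omega>\<in>\<Omega>. \<phi> (point_mass \<omega> (F \<omega>)))"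
      unfolding R_def by (simp add: linear_diff[OF lin] linear_sum[OF lin])
    also have "\<dots> = pairing \<Omega> F g"
      using fin by (simp add: pairing_def avg_def g flip: sum_distrib_left)
    finally show ?thesis .
  qed
  have "Lr_norm (conj_exponent p) \<Omega> g \<le> K"
    by (rule Lr_norm_dual_le[OF p fin K]) (simp add: bound flip: eq)
  then show thesis using eq that by blast
qed

section \<open>Lifting and testing of functionals\<close>

text \<open>If \<open>T\<close> is dominated by \<open>S\<close>, every functional \<open>\<langle>T F, g\<rangle>\<close> factors through \<open>S\<close> with control of the norm.
  This is the Hahn-Banach theorem for the subspace of all \<open>(S F, \<langle>T F, g\<rangle>)\<close>, dominated by
  \<open>c \<parallel>g\<parallel>\<close> times the \<open>L\<^sub>p\<close> norm, followed by the representation of the extension. For \<open>S = D_sgn\<close> and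
  \<open>T = D_long\<close> it produces an admissible \<open>h\<close>.\<close>

lemma dual_lifting:
  fixes S :: "'v::real_vector \<Rightarrow> 'w \<Rightarrow> 'a::real_normed_vector" and T :: "'v \<Rightarrow> 'u \<Rightarrow> 'b::real_normed_vector"
  assumes p: "1 \<le> p" and fin: "finite \<Omega>" "\<Omega> \<noteq> {}" "finite \<Omega>'" "\<Omega>' \<noteq> {}" and c: "0 \<le> c"
    and lin: "linear S" "linear T"
    and bound: "\<And>F. Lr_norm (ereal p) \<Omega>' (T F) \<le> c * Lr_norm (ereal p) \<Omega> (S F)"
  obtains h :: "'w \<Rightarrow> 'a \<Rightarrow>\<^sub>L real"
  where "\<And>F. pairing \<Omega> (S F) h = pairing \<Omega>' (T F) g"
    "Lr_norm (conj_exponent p) \<Omega> h \<le> c * Lr_norm (conj_exponent p) \<Omega>' g"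
proof -
  define K where "K = c * Lr_norm (conj_exponent p) \<Omega>' g"
  have K: "0 \<le> K" unfolding K_def by (rule mult_nonneg_nonneg[OF c Lr_norm_nonneg[OF fin(3,4)]])
  define G where "G = range (\<lambda>F. (S F, pairing \<Omega>' (T F) g))"
  have sub: "sublinear (\<lambda>F :: 'w \<Rightarrow> 'a. K * Lr_norm (ereal p) \<Omega> F)"
  proof (rule sublinearI)
    fix F H :: "'w \<Rightarrow> 'a" and t :: real
    note q = sublinear_Lr_norm[OF p fin(1,2), where 'a = 'a]
    show "K * Lr_norm (ereal p) \<Omega> (F + H) \<le> K * Lr_norm (ereal p) \<Omega> F + K * Lr_norm (ereal p) \<Omega> H"
      using mult_left_mono[OF sublinear_add[OF q] K] by (simp add: distrib_left)
    show "K * Lr_norm (ereal p) \<Omega> (t *\<^sub>R F) \<le> t * (K * Lr_norm (ereal p) \<Omega> F)" if "0 \<le> t"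
      by (simp add: sublinear_scale[OF q that])
  qed
  have mem: "(S F, pairing \<Omega>' (T F) g) \<in> G" for F by (simp add: G_def)
  obtain L where L: "linear L" "\<And>F. L F \<le> K * Lr_norm (ereal p) \<Omega> F" "\<And>v a. (v, a) \<in> G \<Longrightarrow> a \<le> L v"
  proof (rule hahn_banach_cone[OF sub, of G])
    show "(0, 0) \<in> G"
      using mem[of 0] pairing_scaleR_left[of \<Omega>' 0 0 g] by (simp add: linear_0[OF lin(1)] linear_0[OF lin(2)])
    show "(v + w, a + b) \<in> G" if vw: "(v, a) \<in> G" "(w, b) \<in> G" for v a w b
    proof -
      obtain F H where "v = S F" "a = pairing \<Omega>' (T F) g" "w = S H" "b = pairing \<Omega>' (T H) g"
        using vw by (auto simp: G_def)
      then show ?thesis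
        using mem[of "F + H"] by (simp add: linear_add[OF lin(1)] linear_add[OF lin(2)] pairing_add_left)
    qed
    show "(t *\<^sub>R v, t * a) \<in> G" if va: "(v, a) \<in> G" for t v a
    proof -
      obtain F where "v = S F" "a = pairing \<Omega>' (T F) g"
        using va by (auto simp: G_def)
      then show ?thesis
        using mem[of "t *\<^sub>R F"] by (simp add: linear_scale[OF lin(1)] linear_scale[OF lin(2)] pairing_scaleR_left)
    qed
    show "a \<le> K * Lr_norm (ereal p) \<Omega> v" if va: "(v, a) \<in> G" for v a
    proof -
      obtain F where F: "v = S F" "a = pairing \<Omega>' (T F) g"
        using va by (auto simp: G_def)
      have "a \<le> Lr_norm (ereal p) \<Omega>' (T F) * Lr_norm (conj_exponent p) \<Omega>' g"
        unfolding F by (rule holder_pairing[OF p fin(3)])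
      also have "\<dots> \<le> (c * Lr_norm (ereal p) \<Omega> (S F)) * Lr_norm (conj_exponent p) \<Omega>' g"
        by (rule mult_right_mono[OF bound Lr_norm_nonneg[OF fin(3,4)]])
      finally show ?thesis by (simp add: K_def F algebra_simps)
    qed
  qed blast
  obtain h :: "'w \<Rightarrow> 'a \<Rightarrow>\<^sub>L real" where h: "\<And>F. L F = pairing \<Omega> F h" "Lr_norm (conj_exponent p) \<Omega> h \<le> K"
    using Lr_dual_representation[OF p fin(1,2) K L(1,2)] by blast
  have "pairing \<Omega> (S F) h = pairing \<Omega>' (T F) g" for F
  proof (rule order_antisym)
    show "pairing \<Omega>' (T F) g \<le> pairing \<Omega> (S F) h"
      using L(3)[OF mem[of F]] by (simp add: h)
    \<comment> \<open>The prescriptions form a subspace, so the one for the negative of F is available too.\<close>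
    have "- pairing \<Omega>' (T F) g \<le> - pairing \<Omega> (S F) h"
      using L(3)[OF mem[of "(-1) *\<^sub>R F"]]
      by (simp only: h linear_scale[OF lin(1)] linear_scale[OF lin(2)] pairing_scaleR_left)
    then show "pairing \<Omega> (S F) h \<le> pairing \<Omega>' (T F) g" by simp
  qed
  then show thesis using h(2) that unfolding K_def by blast
qed

text \<open>A converse to the lifting: testing \<open>y\<close> against its norming element \<open>g\<close>, each \<open>h\<close> that reproduces the
  value \<open>\<langle>y, g\<rangle>\<close> on \<open>x\<close> must be large if \<open>x\<close> is small compared with \<open>y\<close>. That \<open>g\<close> is nonzero matters
  because the supremum defining \<open>\<Lambda>\<close> ranges over nonzero elements.\<close>

lemma dual_testing:
  fixes y :: "'u \<Rightarrow> 'b::real_normed_vector"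
  assumes p: "1 \<le> p" and fin: "finite \<Omega>" "finite \<Omega>'" "\<Omega>' \<noteq> {}"
    and y: "0 < Lr_norm (ereal p) \<Omega>' y"
  obtains g :: "'u \<Rightarrow> 'b \<Rightarrow>\<^sub>L real"
  where "0 < Lr_norm (conj_exponent p) \<Omega>' g" "Lr_norm (conj_exponent p) \<Omega>' g \<le> 1"
    "\<And>(x :: 'w \<Rightarrow> 'a::real_normed_vector) h. pairing \<Omega> x h = pairing \<Omega>' y g
      \<Longrightarrow> Lr_norm (ereal p) \<Omega>' y \<le> Lr_norm (ereal p) \<Omega> x * Lr_norm (conj_exponent p) \<Omega> h"
proof -
  obtain g :: "'u \<Rightarrow> 'b \<Rightarrow>\<^sub>L real" where g: "pairing \<Omega>' y g = Lr_norm (ereal p) \<Omega>' y"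
    "Lr_norm (conj_exponent p) \<Omega>' g \<le> 1"
    using norming_dual_element[OF p fin(2,3)] by blast
  have "0 < Lr_norm (ereal p) \<Omega>' y * Lr_norm (conj_exponent p) \<Omega>' g"
    using holder_pairing[OF p fin(2), of y g] g(1) y by linarith
  then have "0 < Lr_norm (conj_exponent p) \<Omega>' g" using y by (simp add: zero_less_mult_iff)
  moreover have "Lr_norm (ereal p) \<Omega>' y \<le> Lr_norm (ereal p) \<Omega> x * Lr_norm (conj_exponent p) \<Omega> h"
    if "pairing \<Omega> x h = pairing \<Omega>' y g" for x :: "'w \<Rightarrow> 'a" and h
    using holder_pairing[OF p fin(1), of x h] that g(1) by simp
  ultimately show thesis using that g(2) by blast
qed

section \<open>Difference operators on the grid and their adjoints\<close>

lemma finite_grid: "finite (grid m n)"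
  by (simp add: grid_def finite_PiE)

lemma grid_nonempty: "1 \<le> m \<Longrightarrow> grid m n \<noteq> {}"
  by (auto simp: grid_def PiE_eq_empty_iff)

lemma grid_add_mem: "1 \<le> m \<Longrightarrow> grid_add m n x v \<in> grid m n"
  by (auto simp: grid_def grid_add_def)

lemma grid_diff_mem: "1 \<le> m \<Longrightarrow> grid_diff m n x v \<in> grid m n"
  by (auto simp: grid_def grid_diff_def)

lemma grid_add_diff:
  assumes "x \<in> grid m n"
  shows "grid_add m n (grid_diff m n x v) v = x"
proof (rule PiE_ext)
  show "x \<in> {1..n} \<rightarrow>\<^sub>E UNIV" using assms by (auto simp: grid_def PiE_def)
  show "grid_add m n (grid_diff m n x v) v \<in> {1..n} \<rightarrow>\<^sub>E UNIV" by (simp add: grid_add_def)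
  fix i assume "i \<in> {1..n}"
  moreover from this have "x i \<in> {0..<2 * int m}" using assms by (auto simp: grid_def dest: PiE_mem)
  ultimately show "grid_add m n (grid_diff m n x v) v i = x i"
    by (simp add: grid_add_def grid_diff_def mod_add_left_eq)
qed

lemma grid_diff_add:
  assumes "x \<in> grid m n"
  shows "grid_diff m n (grid_add m n x v) v = x"
proof (rule PiE_ext)
  show "x \<in> {1..n} \<rightarrow>\<^sub>E UNIV" using assms by (auto simp: grid_def PiE_def)
  show "grid_diff m n (grid_add m n x v) v \<in> {1..n} \<rightarrow>\<^sub>E UNIV" by (simp add: grid_diff_def)
  fix i assume "i \<in> {1..n}"
  moreover from this have "x i \<in> {0..<2 * int m}" using assms by (auto simp: grid_def dest: PiE_mem)
  ultimately show "grid_diff m n (grid_add m n x v) v i = x i"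
    by (simp add: grid_add_def grid_diff_def mod_diff_left_eq)
qed

lemma sum_grid_shift:
  fixes \<phi> :: "coords \<Rightarrow> coords \<Rightarrow> real"
  assumes "1 \<le> m"
  shows "(\<Sum>x\<in>grid m n. \<phi> (grid_diff m n x v) x) = (\<Sum>x\<in>grid m n. \<phi> x (grid_add m n x v))"
  by (rule sum.reindex_bij_witness[where i = "\<lambda>x. grid_add m n x v" and j = "\<lambda>x. grid_diff m n x v"])
    (use assms in \<open>simp_all add: grid_add_mem grid_diff_mem grid_add_diff grid_diff_add\<close>)

text \<open>Both difference operators have the form \<open>F(x + \<tau>(j)) - F(x)\<close> for a finite family of shifts \<open>\<tau>\<close>, and the
  adjoint is found by substituting \<open>x - \<tau>(j)\<close> for \<open>x\<close> in the sum over the group. The normalization of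
  the pairing on the product accounts for the factor \<open>1/|J|\<close>.\<close>

lemma shift_difference_adjoint:
  fixes \<tau> :: "'j \<Rightarrow> coords" and F :: "coords \<Rightarrow> 'a::real_normed_vector"
  assumes m: "1 \<le> m" and J: "finite J"
  shows "pairing (grid m n \<times> J) (\<lambda>(x, j). F (grid_add m n x (\<tau> j)) - F x) g
    = pairing (grid m n) F
        (\<lambda>x. (1 / real (card J)) *\<^sub>R (\<Sum>j\<in>J. g (grid_diff m n x (\<tau> j), j) - g (x, j)))"
proof -
  have "(\<Sum>x\<in>grid m n. blinfun_apply (\<Sum>j\<in>J. g (grid_diff m n x (\<tau> j), j) - g (x, j)) (F x))
      = (\<Sum>j\<in>J. \<Sum>x\<in>grid m n. blinfun_apply (g (grid_diff m n x (\<tau> j), j)) (F x) - blinfun_apply (g (x, j)) (F x))"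
    by (subst sum.swap) (simp add: blinfun.sum_left blinfun.diff_left)
  also have "\<dots> = (\<Sum>j\<in>J. \<Sum>x\<in>grid m n. blinfun_apply (g (x, j)) (F (grid_add m n x (\<tau> j)) - F x))"
    using sum_grid_shift[OF m, of "\<lambda>y x. blinfun_apply (g (y, _)) (F x)"]
    by (simp add: sum_subtractf blinfun.diff_right)
  also have "\<dots> = (\<Sum>z\<in>grid m n \<times> J. blinfun_apply (g z) (case z of (x, j) \<Rightarrow> F (grid_add m n x (\<tau> j)) - F x))"
    by (subst sum.swap) (simp add: sum.cartesian_product case_prod_unfold)
  finally show ?thesis
    by (simp add: pairing_def avg_def card_cartesian_product blinfun.scaleR_left
        flip: sum_divide_distrib)
qed

lemma card_signs: "card (signs n) = 2 ^ n"
  by (simp add: signs_def card_PiE flip: numeral_2_eq_2)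

lemma finite_signs: "finite (signs n)"
  by (simp add: signs_def finite_PiE)

lemma signs_nonempty: "signs n \<noteq> {}"
  using card_signs[of n] by auto

lemma D_long_adjoint:
  assumes "1 \<le> m"
  shows "pairing (grid m n \<times> {1..n}) (D_long m n F) g = pairing (grid m n) F (D_long_adj m n g)"
  using shift_difference_adjoint[OF assms, of "{1..n}" n F "\<lambda>j i. int m * basis_vec j i" g]
  by (simp add: D_long_def D_long_adj_def[abs_def])

lemma D_sgn_adjoint:
  assumes "1 \<le> m"
  shows "pairing (grid m n \<times> signs n) (D_sgn m n F) h = pairing (grid m n) F (D_sgn_adj m n h)"
  using shift_difference_adjoint[OF assms finite_signs, of n n F "\<lambda>\<epsilon>. \<epsilon>" h]
  by (simp add: D_sgn_def D_sgn_adj_def[abs_def] card_signs)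

lemma linear_D_long: "linear (D_long m n :: (coords \<Rightarrow> 'a::real_normed_vector) \<Rightarrow> _)"
  by (rule linearI) (auto simp: D_long_def fun_eq_iff algebra_simps)

lemma linear_D_sgn: "linear (D_sgn m n :: (coords \<Rightarrow> 'a::real_normed_vector) \<Rightarrow> _)"
  by (rule linearI) (auto simp: D_sgn_def fun_eq_iff algebra_simps)

text \<open>Admissibility of \<open>h\<close> for \<open>g\<close> in weak form; the pairing with point masses recovers the pointwise
  equation.\<close>

lemma D_sgn_adj_eq_iff:
  assumes "1 \<le> m"
  shows "(\<forall>x\<in>grid m n. D_sgn_adj m n h x = D_long_adj m n g x)
    \<longleftrightarrow> (\<forall>F :: coords \<Rightarrow> 'a::real_normed_vector.
          pairing (grid m n \<times> signs n) (D_sgn m n F) h = pairing (grid m n \<times> {1..n}) (D_long m n F) g)"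
    (is "?pointwise \<longleftrightarrow> ?weak")
proof
  assume ?pointwise
  then have "pairing (grid m n) F (D_sgn_adj m n h) = pairing (grid m n) F (D_long_adj m n g)" for F
    unfolding pairing_def by (intro avg_cong) simp
  then show ?weak by (simp only: D_sgn_adjoint[OF assms] D_long_adjoint[OF assms] simp_thms)
next
  assume ?weak
  then have "pairing (grid m n) F (D_sgn_adj m n h) = pairing (grid m n) F (D_long_adj m n g)" for F
    by (simp only: D_sgn_adjoint[OF assms] D_long_adjoint[OF assms])
  then show ?pointwise by (blast intro: pairing_separates[OF finite_grid])
qed

section \<open>Equality of the two constants\<close>

theorem theorem1p1:
  fixes p :: real and n m :: nat
  assumes "1 \<le> p" and "1 \<le> n" and "1 \<le> m"
  shows "Lambda_const (conj_exponent p) TYPE('a::banach \<Rightarrow>\<^sub>L real) n m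
           = C_const p TYPE('a) n m"
proof -
  define q where "q = conj_exponent p"
  define \<Omega>l where "\<Omega>l = grid m n \<times> {1..n}"
  define \<Omega>s where "\<Omega>s = grid m n \<times> signs n"
  have finl: "finite \<Omega>l" "\<Omega>l \<noteq> {}" and fins: "finite \<Omega>s" "\<Omega>s \<noteq> {}"
    using assms by (auto simp: \<Omega>l_def \<Omega>s_def finite_grid finite_signs grid_nonempty signs_nonempty)
  define adm where "adm g = {h :: coords \<times> coords \<Rightarrow> 'a \<Rightarrow>\<^sub>L real.
      \<forall>x\<in>grid m n. D_sgn_adj m n h x = D_long_adj m n g x}" for g
  have adm_iff: "h \<in> adm g \<longleftrightarrow> (\<forall>F. pairing \<Omega>s (D_sgn m n F) h = pairing \<Omega>l (D_long m n F) g)" for g h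
    unfolding adm_def \<Omega>l_def \<Omega>s_def mem_Collect_eq by (rule D_sgn_adj_eq_iff[OF assms(3)])
  define lift where "lift g = (INF h\<in>adm g. ennreal (Lr_norm q \<Omega>s h))" for g
  define \<Lambda> where "\<Lambda> = Lambda_const q TYPE('a \<Rightarrow>\<^sub>L real) n m"
  define C where "C = C_const p TYPE('a) n m"
  have \<Lambda>_eq: "\<Lambda> = (SUP g\<in>{g. \<exists>z\<in>\<Omega>l. g z \<noteq> 0}. lift g / ennreal (Lr_norm q \<Omega>l g))"
    unfolding \<Lambda>_def Lambda_const_def lift_def adm_def \<Omega>l_def \<Omega>s_def ..
  define ker where "ker \<longleftrightarrow> (\<forall>F :: coords \<Rightarrow> 'a. (\<forall>z\<in>\<Omega>s. D_sgn m n F z = 0) \<longrightarrow> (\<forall>z\<in>\<Omega>l. D_long m n F z = 0))"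
  have C_eq: "C = (if ker then SUP F\<in>{F :: coords \<Rightarrow> 'a. \<exists>z\<in>\<Omega>s. D_sgn m n F z \<noteq> 0}.
      ennreal (Lr_norm (ereal p) \<Omega>l (D_long m n F)) / ennreal (Lr_norm (ereal p) \<Omega>s (D_sgn m n F)) else \<infinity>)"
    unfolding C_def C_const_def ker_def \<Omega>l_def \<Omega>s_def ..
  have p1: "1 \<le> ereal p" and q1: "1 \<le> q"
    using assms(1) conj_exponent_ge_1[OF assms(1)] by (simp_all add: q_def)
  have "\<Lambda> \<le> C"
  proof (cases "C = \<infinity>")
    case False
    then obtain c where c: "0 \<le> c" "C = ennreal c" by (cases C) auto
    have ker: ker using False unfolding C_eq by (metis (full_types))
    \<comment> \<open>As a multiplicative bound the estimate also covers the functions in the kernel of the sign differences.\<close>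
    have bound: "Lr_norm (ereal p) \<Omega>l (D_long m n F) \<le> c * Lr_norm (ereal p) \<Omega>s (D_sgn m n F)"
      for F :: "coords \<Rightarrow> 'a"
    proof (cases "\<exists>z\<in>\<Omega>s. D_sgn m n F z \<noteq> 0")
      case True
      define a where "a = Lr_norm (ereal p) \<Omega>l (D_long m n F)"
      define b where "b = Lr_norm (ereal p) \<Omega>s (D_sgn m n F)"
      have b: "0 < b" using True Lr_norm_eq_0_iff[OF fins p1, of "D_sgn m n F"] Lr_norm_nonneg[OF fins, of "ereal p" "D_sgn m n F"]
        by (auto simp: b_def less_le)
      have "ennreal a / ennreal b \<le> C"
        unfolding C_eq a_def b_def using True ker by (auto intro!: SUP_upper)
      then have "a / b \<le> c"
        using b c Lr_norm_nonneg[OF finl, of "ereal p" "D_long m n F"] by (simp add: divide_ennreal a_def)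
      then show ?thesis using b by (simp add: a_def b_def field_simps)
    next
      case F: False
      then have "Lr_norm (ereal p) \<Omega>l (D_long m n F) = 0"
        unfolding Lr_norm_eq_0_iff[OF finl p1] using ker by (simp add: ker_def)
      then show ?thesis using c(1) Lr_norm_nonneg[OF fins, of "ereal p" "D_sgn m n F"] by simp
    qed
    show ?thesis
      unfolding \<Lambda>_eq
    proof (rule SUP_least)
      fix g :: "coords \<times> nat \<Rightarrow> 'a \<Rightarrow>\<^sub>L real" assume "g \<in> {g. \<exists>z\<in>\<Omega>l. g z \<noteq> 0}"
      then have g: "0 < Lr_norm q \<Omega>l g"
        using Lr_norm_eq_0_iff[OF finl q1, of g] Lr_norm_nonneg[OF finl, of q g] by (auto simp: less_le)
      obtain h where h: "\<And>F. pairing \<Omega>s (D_sgn m n F) h = pairing \<Omega>l (D_long m n F) g"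
        "Lr_norm q \<Omega>s h \<le> c * Lr_norm q \<Omega>l g"
        using dual_lifting[OF assms(1) fins finl c(1) linear_D_sgn linear_D_long bound]
        unfolding q_def by blast
      have "lift g \<le> ennreal (Lr_norm q \<Omega>s h)"
        unfolding lift_def by (rule INF_lower) (simp add: adm_iff h)
      also have "\<dots> \<le> ennreal (Lr_norm q \<Omega>l g) * C"
        using ennreal_leI[OF h(2)] c g by (simp add: ennreal_mult mult.commute)
      finally show "lift g / ennreal (Lr_norm q \<Omega>l g) \<le> C"
        using g by (intro divide_le_posI_ennreal) (auto simp: mult.commute)
    qed
  qed simp
  moreover have "C \<le> \<Lambda>"
  proof (cases "\<Lambda> = \<infinity>")
    case False
    have bound: "ennreal (Lr_norm (ereal p) \<Omega>l (D_long m n F)) / ennreal (Lr_norm (ereal p) \<Omega>s (D_sgn m n F)) \<le> \<Lambda>"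
      for F :: "coords \<Rightarrow> 'a"
    proof (cases "Lr_norm (ereal p) \<Omega>l (D_long m n F) = 0")
      case F: False
      define a where "a = Lr_norm (ereal p) \<Omega>l (D_long m n F)"
      define b where "b = Lr_norm (ereal p) \<Omega>s (D_sgn m n F)"
      have a: "0 < a" and b: "0 \<le> b"
        using F Lr_norm_nonneg[OF finl, of "ereal p" "D_long m n F"] Lr_norm_nonneg[OF fins, of "ereal p" "D_sgn m n F"]
        by (auto simp: a_def b_def less_le)
      obtain g where g: "0 < Lr_norm q \<Omega>l g" "Lr_norm q \<Omega>l g \<le> 1"
        and test: "\<And>h. h \<in> adm g \<Longrightarrow> a \<le> b * Lr_norm q \<Omega>s h"
        using dual_testing[OF assms(1) fins(1) finl a[unfolded a_def]]
        unfolding adm_iff a_def b_def q_def by metis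
      have "\<exists>z\<in>\<Omega>l. g z \<noteq> 0" using g(1) Lr_norm_eq_0_iff[OF finl q1, of g] by force
      then have "lift g / ennreal (Lr_norm q \<Omega>l g) \<le> \<Lambda>"
        unfolding \<Lambda>_eq by (intro SUP_upper) simp
      then have "(lift g / ennreal (Lr_norm q \<Omega>l g)) * ennreal (Lr_norm q \<Omega>l g) \<le> \<Lambda> * ennreal (Lr_norm q \<Omega>l g)"
        by (rule mult_right_mono) simp
      then have "lift g \<le> \<Lambda> * ennreal (Lr_norm q \<Omega>l g)"
        using g(1) by (simp add: ennreal_divide_times)
      also have "\<dots> \<le> \<Lambda> * 1"
        using g(2) by (intro mult_left_mono) simp_all
      finally have lift: "lift g \<le> \<Lambda>" by simp
      \<comment> \<open>A finite infimum needs a lift, and since a is positive a lift can exist only if b is positive.\<close>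
      have "adm g \<noteq> {}" using lift False by (auto simp: lift_def top_unique)
      then have b_pos: "0 < b" using test a b by (cases "b = 0") auto
      have "ennreal a / ennreal b \<le> lift g"
        unfolding lift_def
      proof (rule INF_greatest)
        fix h assume "h \<in> adm g"
        then show "ennreal a / ennreal b \<le> ennreal (Lr_norm q \<Omega>s h)"
          using test b_pos a by (simp add: divide_ennreal field_simps ennreal_leI)
      qed
      then show ?thesis using lift by (simp add: a_def b_def)
    qed simp
    have ker
      unfolding ker_def
    proof (intro allI impI)
      fix F :: "coords \<Rightarrow> 'a"
      assume "\<forall>z\<in>\<Omega>s. D_sgn m n F z = 0"
      then have "Lr_norm (ereal p) \<Omega>s (D_sgn m n F) = 0"
        unfolding Lr_norm_eq_0_iff[OF fins p1] .
      then have "Lr_norm (ereal p) \<Omega>l (D_long m n F) = 0"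
        using bound[of F] False Lr_norm_nonneg[OF finl, of "ereal p" "D_long m n F"]
        by (auto simp: top_unique ennreal_eq_0_iff split: if_splits)
      then show "\<forall>z\<in>\<Omega>l. D_long m n F z = 0"
        unfolding Lr_norm_eq_0_iff[OF finl p1] .
    qed
    then show ?thesis using bound by (auto simp: C_eq intro!: SUP_least)
  qed simp
  ultimately show ?thesis by (simp add: \<Lambda>_def C_def q_def)
qed

end
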